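(* Let $L$ be a Lie algebra or a $3$-Lie algebra over a field $\mathbb{k}$, and let $X=\mathbb{k}\oplus L$, $T$, $R:X^{\otimes 2}\otimes X^{\otimes 2}\to X^{\otimes 2}\otimes X^{\otimes 2}$ and $\theta:X^{\otimes 2}\to X^{\otimes 2}$ be as in the context. Then $$R\circ(\theta\otimes\mathbf 1)=(\mathbf 1\otimes\theta)\circ R,\qquad R\circ(\mathbf 1\otimes\theta)=(\theta\otimes\mathbf 1)\circ R,$$ where $\mathbf 1$ denotes the identity of $X^{\otimes 2}$.
   Context: A $3$-Lie algebra over $\mathbb{k}$ is a $\mathbb{k}$-vector space $L$ with a trilinear map $[\cdot,\cdot,\cdot]$ such that $[x_1,x_2,x_3]=\mathrm{sgn}(\sigma)[x_{\sigma(1)},x_{\sigma(2)},x_{\sigma(3)}]$ for every permutation $\sigma$ of $\{1,2,3\}$, and $[[x_1,x_2,x_3],x_4,x_5]=[[x_1,x_4,x_5],x_2,x_3]+[x_1,[x_2,x_4,x_5],x_3]+[x_1,x_2,[x_3,x_4,x_5]]$. Elements of $X=\mathbb{k}\oplus L$ are pairs $(a,x)$; tensor products are over $\mathbb{k}$. $\Delta(a,x)=(a,x)\otimes(1,0)+(1,0)\otimes(0,x)$, and Sweedler notation $(\mathrm{id}\otimes\Delta)\Delta(x)=x^{(1)}\otimes x^{(2)}\otimes x^{(3)}$ is used. The linear map $T:X^{\otimes 3}\to X$ is $$T((a,x)\otimes(b,y)\otimes(c,z))=(abc,\ bcx+c[x,y]+b[x,z]+[[x,y],z])\quad\text{if }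 L \text{ is a Lie algebra},$$ $$T((a,x)\otimes(b,y)\otimes(c,z))=(abc,\ bcx+[x,y,z])\quad\text{if } L\text{ is a }3\text{-Lie algebra}.$$ The linear maps $R$ and $\theta$ are $$R(x\otimes y\otimes z\otimes w)= z^{(1)}\otimes w^{(1)}\otimes T(x\otimes z^{(2)}\otimes w^{(2)})\otimes T(y\otimes z^{(3)}\otimes w^{(3)}),$$ $$\theta(x\otimes y)=T(x^{(1)}\otimes x^{(2)}\otimes y^{(2)})\otimes T(y^{(1)}\otimes x^{(3)}\otimes y^{(3)}),$$ for $x,y,z,w\in X$. *)

theory Defs
  imports "HOL-Library.Poly_Mapping" "HOL-Combinatorics.Permutations" "HOL-Analysis.Product_Vector"
begin

section \<open>Tensor products over an arbitrary field\<close>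

text \<open>
  Tensor products must be formed iteratively (of \<open>X \<otimes> X\<close> with itself, for instance), so a vector
  space is given here by a scalar multiplication on an ambient type together with a carrier, which
  is a subspace of the ambient type.
\<close>

record ('k, 'v) vspace =
  scl :: "'k \<Rightarrow> 'v \<Rightarrow> 'v"
  car :: "'v set"

definition is_vspace :: "('k::field, 'v::ab_group_add) vspace \<Rightarrow> bool" where
  "is_vspace V \<longleftrightarrow> vector_space (scl V) \<and> module.subspace (scl V) (car V)"

definition free_scale :: "'k::field \<Rightarrow> ('i \<Rightarrow>\<^sub>0 'k) \<Rightarrow> ('i \<Rightarrow>\<^sub>0 'k)" where
  "free_scale c u = Poly_Mapping.map ((*) c) u"

abbreviation gen :: "'a \<Rightarrow> 'b \<Rightarrow> ('a \<times> 'b) \<Rightarrow>\<^sub>0 'k::field" where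
  "gen a b \<equiv> Poly_Mapping.single (a, b) 1"

definition tensor_rels ::
  "('k::field, 'a::ab_group_add) vspace \<Rightarrow> ('k, 'b::ab_group_add) vspace \<Rightarrow> (('a \<times> 'b) \<Rightarrow>\<^sub>0 'k) set"
  where
  "tensor_rels V W =
     {gen (a + a') b - gen a b - gen a' b | a a' b. a \<in> car V \<and> a' \<in> car V \<and> b \<in> car W} \<union>
     {gen a (b + b') - gen a b - gen a b' | a b b'. a \<in> car V \<and> b \<in> car W \<and> b' \<in> car W} \<union>
     {gen (scl V c a) b - free_scale c (gen a b) | c a b. a \<in> car V \<and> b \<in> car W} \<union>
     {gen a (scl W c b) - free_scale c (gen a b) | c a b. a \<in> car V \<and> b \<in> car W}"

text \<open>
  \<open>V \<otimes> W\<close> is the free vector space on \<open>car V \<times> car W\<close> modulo the span \<open>N\<close> of the bilinearity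
  relations. The quotient by \<open>N\<close> is realised inside the free vector space as the image of a linear
  idempotent with kernel \<open>N\<close>; the universal property is proved below.
\<close>

definition tensor_proj ::
  "('k::field, 'a::ab_group_add) vspace \<Rightarrow> ('k, 'b::ab_group_add) vspace
     \<Rightarrow> (('a \<times> 'b) \<Rightarrow>\<^sub>0 'k) \<Rightarrow> (('a \<times> 'b) \<Rightarrow>\<^sub>0 'k)"
  where
  "tensor_proj V W = (SOME p. Vector_Spaces.linear free_scale free_scale p \<and> (\<forall>u. p (p u) = p u) \<and>
     {u. p u = 0} = module.span free_scale (tensor_rels V W))"

definition pure ::
  "('k::field, 'a::ab_group_add) vspace \<Rightarrow> ('k, 'b::ab_group_add) vspace
     \<Rightarrow> 'a \<Rightarrow> 'b \<Rightarrow> (('a \<times> 'b) \<Rightarrow>\<^sub>0 'k)"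
  where "pure V W a b = tensor_proj V W (gen a b)"

definition tensor ::
  "('k::field, 'a::ab_group_add) vspace \<Rightarrow> ('k, 'b::ab_group_add) vspace
     \<Rightarrow> ('k, ('a \<times> 'b) \<Rightarrow>\<^sub>0 'k) vspace"
  where
  "tensor V W = \<lparr>scl = free_scale,
     car = module.span free_scale {pure V W a b | a b. a \<in> car V \<and> b \<in> car W}\<rparr>"

definition bilinear_on ::
  "('k, 'a::ab_group_add) vspace \<Rightarrow> ('k, 'b::ab_group_add) vspace
     \<Rightarrow> ('k, 'c::ab_group_add) vspace \<Rightarrow> ('a \<Rightarrow> 'b \<Rightarrow> 'c) \<Rightarrow> bool"
  where
  "bilinear_on V W U f \<longleftrightarrow>
     (\<forall>a\<in>car V. \<forall>a'\<in>car V. \<forall>b\<in>car W. f (a + a') b = f a b + f a' b) \<and>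
     (\<forall>a\<in>car V. \<forall>b\<in>car W. \<forall>b'\<in>car W. f a (b + b') = f a b + f a b') \<and>
     (\<forall>c. \<forall>a\<in>car V. \<forall>b\<in>car W. f (scl V c a) b = scl U c (f a b)) \<and>
     (\<forall>c. \<forall>a\<in>car V. \<forall>b\<in>car W. f a (scl W c b) = scl U c (f a b))"

text \<open>
  The linear map on \<open>V \<otimes> W\<close> sending \<open>a \<otimes> b\<close> to \<open>f a b\<close>. For bilinear \<open>f\<close> it exists and its
  restriction to the carrier is unique; its values outside the carrier carry no information.
\<close>

definition lift ::
  "('k::field, 'a::ab_group_add) vspace \<Rightarrow> ('k, 'b::ab_group_add) vspace
     \<Rightarrow> ('k, 'c::ab_group_add) vspace \<Rightarrow> ('a \<Rightarrow> 'b \<Rightarrow> 'c) \<Rightarrow> (('a \<times> 'b) \<Rightarrow>\<^sub>0 'k) \<Rightarrow> 'c"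
  where
  "lift V W U f = (SOME g. Vector_Spaces.linear free_scale (scl U) g \<and>
     (\<forall>a\<in>car V. \<forall>b\<in>car W. g (pure V W a b) = f a b))"

definition tensor_map ::
  "('k::field, 'a::ab_group_add) vspace \<Rightarrow> ('k, 'b::ab_group_add) vspace
     \<Rightarrow> ('k, 'c::ab_group_add) vspace \<Rightarrow> ('k, 'd::ab_group_add) vspace
     \<Rightarrow> ('a \<Rightarrow> 'c) \<Rightarrow> ('b \<Rightarrow> 'd) \<Rightarrow> (('a \<times> 'b) \<Rightarrow>\<^sub>0 'k) \<Rightarrow> (('c \<times> 'd) \<Rightarrow>\<^sub>0 'k)"
  where
  "tensor_map V W V' W' g h = lift V W (tensor V' W') (\<lambda>a b. pure V' W' (g a) (h b))"

definition lift3 ::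
  "('k::field, 'a::ab_group_add) vspace \<Rightarrow> ('k, 'c::ab_group_add) vspace
     \<Rightarrow> ('a \<Rightarrow> 'a \<Rightarrow> 'a \<Rightarrow> 'c) \<Rightarrow> (('a \<times> (('a \<times> 'a) \<Rightarrow>\<^sub>0 'k)) \<Rightarrow>\<^sub>0 'k) \<Rightarrow> 'c"
  where
  "lift3 V U f = lift V (tensor V V) U (\<lambda>a. lift V V U (f a))"

subsection \<open>Universal property\<close>

lemma lookup_free_scale [simp]:
  "Poly_Mapping.lookup (free_scale c u) i = c * Poly_Mapping.lookup u i"
  by (simp add: free_scale_def Poly_Mapping.map.rep_eq when_def)

lemma vector_space_free_scale: "vector_space free_scale"
  by unfold_locales (auto intro!: poly_mapping_eqI simp: lookup_add algebra_simps)

interpretation free: vector_space free_scale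
  by (rule vector_space_free_scale)

interpretation free_pair: vector_space_pair free_scale free_scale ..

lemma tensor_proj_ex:
  fixes S :: "('i \<Rightarrow>\<^sub>0 'k::field) set"
  shows "\<exists>p. Vector_Spaces.linear free_scale free_scale p \<and> (\<forall>u. p (p u) = p u) \<and>
     {u. p u = 0} = free.span S"
proof -
  obtain B where B: "B \<subseteq> free.span S" "free.independent B" "free.span S \<subseteq> free.span B"
    using free.maximal_independent_subset[of "free.span S"] by blast
  define E where "E = free.extend_basis B"
  have E: "B \<subseteq> E" "free.independent E" "free.span E = UNIV"
    using free.extend_basis_superset[OF B(2)] free.independent_extend_basis[OF B(2)]
      free.span_extend_basis[OF B(2)] by (auto simp: E_def)
  define p :: "('i \<Rightarrow>\<^sub>0 'k) \<Rightarrow> ('i \<Rightarrow>\<^sub>0 'k)"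
    where "p = free_pair.construct E (\<lambda>b. if b \<in> B then 0 else b)"
  have lin: "Vector_Spaces.linear free_scale free_scale p"
    unfolding p_def by (rule free_pair.linear_construct[OF E(2)])
  interpret p: Vector_Spaces.linear free_scale free_scale p by (rule lin)
  have pb: "p b = (if b \<in> B then 0 else b)" if "b \<in> E" for b
    unfolding p_def by (simp add: free_pair.construct_basis[OF E(2) that])
  have sB: "free.span B = free.span S"
    using B by (metis free.span_span free.span_mono subset_antisym)
  have p0: "p u = 0" if "u \<in> free.span B" for u
    using that
  proof (induction rule: free.span_induct_alt)
    case (step c x y)
    then show ?case using pb E(1) by (auto simp: p.add p.scale)
  qed simp
  have diff: "u - p u \<in> free.span B" for u
  proof -
    have "u \<in> free.span E" using E(3) by simp
    then show ?thesis
    proof (induction rule: free.span_induct_alt)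
      case base
      show ?case by (simp add: free.span_zero)
    next
      case (step c x y)
      have eq: "free_scale c x + y - p (free_scale c x + y) = free_scale c (x - p x) + (y - p y)"
        by (simp add: p.add p.scale free.scale_right_diff_distrib)
      have "x - p x \<in> free.span B"
        using pb[OF step(1)] by (auto simp: free.span_base free.span_zero)
      then show ?case unfolding eq by (intro free.span_add free.span_scale step)
    qed
  qed
  have "p (p u) = p u" for u
    using p0[OF diff[of u]] by (simp add: p.diff)
  moreover have "{u. p u = 0} = free.span S"
    using p0 diff sB by (metis (mono_tags, lifting) Collect_cong Collect_mem_eq diff_zero)
  ultimately show ?thesis using lin by blast
qed

lemma tensor_proj:
  shows linear_tensor_proj: "Vector_Spaces.linear free_scale free_scale (tensor_proj V W)"
    and tensor_proj_idem: "tensor_proj V W (tensor_proj V W u) = tensor_proj V W u"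
    and tensor_proj_eq_0_iff: "tensor_proj V W u = 0 \<longleftrightarrow> u \<in> free.span (tensor_rels V W)"
proof -
  have "Vector_Spaces.linear free_scale free_scale (tensor_proj V W) \<and>
     (\<forall>u. tensor_proj V W (tensor_proj V W u) = tensor_proj V W u) \<and>
     {u. tensor_proj V W u = 0} = free.span (tensor_rels V W)"
    unfolding tensor_proj_def by (rule someI_ex[OF tensor_proj_ex])
  then show "Vector_Spaces.linear free_scale free_scale (tensor_proj V W)"
    "tensor_proj V W (tensor_proj V W u) = tensor_proj V W u"
    "tensor_proj V W u = 0 \<longleftrightarrow> u \<in> free.span (tensor_rels V W)"
    by blast+
qed

lemma is_vspace_tensor: "is_vspace (tensor V W)"
  by (simp add: is_vspace_def tensor_def vector_space_free_scale free.subspace_span)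

lemma scl_tensor [simp]: "scl (tensor V W) = free_scale"
  by (simp add: tensor_def)

lemma pure_in_tensor: "a \<in> car V \<Longrightarrow> b \<in> car W \<Longrightarrow> pure V W a b \<in> car (tensor V W)"
  by (auto simp: tensor_def intro!: free.span_base)

lemma bilinear_on_pure: "bilinear_on V W (tensor V W) (pure V W)"
proof -
  interpret p: Vector_Spaces.linear free_scale free_scale "tensor_proj V W"
    by (rule linear_tensor_proj)
  have rel: "tensor_proj V W u = 0" if "u \<in> tensor_rels V W" for u
    using that by (simp add: tensor_proj_eq_0_iff free.span_base)
  have 1: "pure V W (a + a') b = pure V W a b + pure V W a' b"
    if "a \<in> car V" "a' \<in> car V" "b \<in> car W" for a a' b
  proof -
    have "gen (a + a') b - gen a b - gen a' b \<in> tensor_rels V W"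
      unfolding tensor_rels_def using that by blast
    from rel[OF this] show ?thesis by (simp add: pure_def p.add p.diff p.scale algebra_simps)
  qed
  have 2: "pure V W a (b + b') = pure V W a b + pure V W a b'"
    if "a \<in> car V" "b \<in> car W" "b' \<in> car W" for a b b'
  proof -
    have "gen a (b + b') - gen a b - gen a b' \<in> tensor_rels V W"
      unfolding tensor_rels_def using that by blast
    from rel[OF this] show ?thesis by (simp add: pure_def p.add p.diff p.scale algebra_simps)
  qed
  have 3: "pure V W (scl V c a) b = free_scale c (pure V W a b)"
    if "a \<in> car V" "b \<in> car W" for c a b
  proof -
    have "gen (scl V c a) b - free_scale c (gen a b) \<in> tensor_rels V W"
      unfolding tensor_rels_def using that by blast
    from rel[OF this] show ?thesis by (simp add: pure_def p.add p.diff p.scale algebra_simps)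
  qed
  have 4: "pure V W a (scl W c b) = free_scale c (pure V W a b)"
    if "a \<in> car V" "b \<in> car W" for c a b
  proof -
    have "gen a (scl W c b) - free_scale c (gen a b) \<in> tensor_rels V W"
      unfolding tensor_rels_def using that by blast
    from rel[OF this] show ?thesis by (simp add: pure_def p.add p.diff p.scale algebra_simps)
  qed
  show ?thesis
    unfolding bilinear_on_def using 1 2 3 4 by simp
qed

lemma lift_ex:
  fixes V :: "('k::field, 'a::ab_group_add) vspace" and W :: "('k, 'b::ab_group_add) vspace"
    and U :: "('k, 'c::ab_group_add) vspace"
  assumes U: "vector_space (scl U)" and f: "bilinear_on V W U f"
  shows "\<exists>g. Vector_Spaces.linear free_scale (scl U) g \<and>
     (\<forall>a\<in>car V. \<forall>b\<in>car W. g (pure V W a b) = f a b)"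
proof -
  interpret U: vector_space "scl U" by (rule U)
  define g where "g u = (\<Sum>i\<in>Poly_Mapping.keys u. scl U (Poly_Mapping.lookup u i) (f (fst i) (snd i)))"
    for u :: "('a \<times> 'b) \<Rightarrow>\<^sub>0 'k"
  have g_eq: "g u = (\<Sum>i\<in>I. scl U (Poly_Mapping.lookup u i) (f (fst i) (snd i)))"
    if "finite I" "Poly_Mapping.keys u \<subseteq> I" for u I
    unfolding g_def using that
    by (intro sum.mono_neutral_left) (auto simp: in_keys_iff)
  have g_add: "g (u + v) = g u + g v" for u v
  proof -
    let ?I = "Poly_Mapping.keys u \<union> Poly_Mapping.keys v"
    have "Poly_Mapping.keys (u + v) \<subseteq> ?I" by (rule keys_add)
    then show ?thesis
      by (simp add: g_eq[of ?I] lookup_add U.scale_left_distrib sum.distrib)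
  qed
  have g_scale: "g (free_scale c u) = scl U c (g u)" for c u
  proof -
    have "Poly_Mapping.keys (free_scale c u) \<subseteq> Poly_Mapping.keys u"
      by (auto simp: in_keys_iff)
    then show ?thesis
      by (simp add: g_eq[of "Poly_Mapping.keys u"] U.scale_sum_right)
  qed
  have lin: "Vector_Spaces.linear free_scale (scl U) g"
    unfolding Vector_Spaces.linear_def module_hom_def module_hom_axioms_def
    using U g_add g_scale vector_space_free_scale by (auto simp: module_iff_vector_space)
  interpret g: Vector_Spaces.linear free_scale "scl U" g by (rule lin)
  have g_gen: "g (gen a b) = f a b" for a b
    by (simp add: g_def)
  have g_rel: "g u = 0" if "u \<in> tensor_rels V W" for u
    using that f unfolding tensor_rels_def bilinear_on_def
    by (auto simp: g.diff g.scale g_gen)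
  have g_ker: "g u = 0" if "u \<in> free.span (tensor_rels V W)" for u
    using that by (induction rule: free.span_induct_alt) (auto simp: g.add g.scale g_rel)
  have "g (tensor_proj V W u) = g u" for u
  proof -
    interpret p: Vector_Spaces.linear free_scale free_scale "tensor_proj V W"
      by (rule linear_tensor_proj)
    have "tensor_proj V W (tensor_proj V W u - u) = 0"
      by (simp add: p.diff tensor_proj_idem)
    then have "g (tensor_proj V W u - u) = 0"
      using g_ker tensor_proj_eq_0_iff by blast
    then show ?thesis by (simp add: g.diff)
  qed
  then show ?thesis using lin g_gen by (auto simp: pure_def)
qed

lemma
  assumes "vector_space (scl U)" and "bilinear_on V W U f"
  shows linear_lift: "Vector_Spaces.linear free_scale (scl U) (lift V W U f)"
    and lift_pure: "\<And>a b. a \<in> car V \<Longrightarrow> b \<in> car W \<Longrightarrow> lift V W U f (pure V W a b) = f a b"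
  using someI_ex[OF lift_ex[OF assms]] unfolding lift_def by blast+

lemma tensor_linear_ext:
  assumes g: "Vector_Spaces.linear free_scale s g" and h: "Vector_Spaces.linear free_scale s h"
    and eq: "\<And>a b. a \<in> car V \<Longrightarrow> b \<in> car W \<Longrightarrow> g (pure V W a b) = h (pure V W a b)"
    and t: "t \<in> car (tensor V W)"
  shows "g t = h t"
proof -
  interpret g: Vector_Spaces.linear free_scale s g by (rule g)
  interpret h: Vector_Spaces.linear free_scale s h by (rule h)
  have "t \<in> free.span {pure V W a b | a b. a \<in> car V \<and> b \<in> car W}"
    using t by (simp add: tensor_def)
  then show ?thesis
    by (induction rule: free.span_induct_alt) (auto simp: g.add g.scale h.add h.scale eq)
qed

section \<open>Lie algebras and 3-Lie algebras\<close>

definition lie_algebra ::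
  "('k::field \<Rightarrow> 'l::ab_group_add \<Rightarrow> 'l) \<Rightarrow> ('l \<Rightarrow> 'l \<Rightarrow> 'l) \<Rightarrow> bool"
  where
  "lie_algebra s br \<longleftrightarrow> vector_space s \<and>
     (\<forall>x. Vector_Spaces.linear s s (\<lambda>y. br x y)) \<and>
     (\<forall>y. Vector_Spaces.linear s s (\<lambda>x. br x y)) \<and>
     (\<forall>x. br x x = 0) \<and>
     (\<forall>x y z. br x (br y z) + br y (br z x) + br z (br x y) = 0)"

definition three_lie_algebra ::
  "('k::field \<Rightarrow> 'l::ab_group_add \<Rightarrow> 'l) \<Rightarrow> ('l \<Rightarrow> 'l \<Rightarrow> 'l \<Rightarrow> 'l) \<Rightarrow> bool"
  where
  "three_lie_algebra s br \<longleftrightarrow> vector_space s \<and>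
     (\<forall>y z. Vector_Spaces.linear s s (\<lambda>x. br x y z)) \<and>
     (\<forall>x z. Vector_Spaces.linear s s (\<lambda>y. br x y z)) \<and>
     (\<forall>x y. Vector_Spaces.linear s s (\<lambda>z. br x y z)) \<and>
     (\<forall>\<sigma> (x :: nat \<Rightarrow> 'l). \<sigma> permutes {1, 2, 3} \<longrightarrow>
        br (x 1) (x 2) (x 3) = s (of_int (sign \<sigma>)) (br (x (\<sigma> 1)) (x (\<sigma> 2)) (x (\<sigma> 3)))) \<and>
     (\<forall>x1 x2 x3 x4 x5. br (br x1 x2 x3) x4 x5 =
        br (br x1 x4 x5) x2 x3 + br x1 (br x2 x4 x5) x3 + br x1 x2 (br x3 x4 x5))"

section \<open>The space \<open>X = k \<oplus> L\<close> and the maps \<open>T\<close>, \<open>R\<close>, \<open>\<theta>\<close>\<close>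

definition Xsp :: "('k::field \<Rightarrow> 'l::ab_group_add \<Rightarrow> 'l) \<Rightarrow> ('k, 'k \<times> 'l) vspace" where
  "Xsp s = \<lparr>scl = module_prod.scale (*) s, car = UNIV\<rparr>"

abbreviation X2 where "X2 s \<equiv> tensor (Xsp s) (Xsp s)"
abbreviation X3 where "X3 s \<equiv> tensor (Xsp s) (X2 s)"
abbreviation X4 where "X4 s \<equiv> tensor (X2 s) (X2 s)"

abbreviation pure2 where "pure2 s x y \<equiv> pure (Xsp s) (Xsp s) x y"
abbreviation pure3 where "pure3 s x y z \<equiv> pure (Xsp s) (X2 s) x (pure2 s y z)"
abbreviation pure4 where "pure4 s x y z w \<equiv> pure (X2 s) (X2 s) (pure2 s x y) (pure2 s z w)"

type_synonym ('k, 'l) X2 = "(('k \<times> 'l) \<times> ('k \<times> 'l)) \<Rightarrow>\<^sub>0 'k"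
type_synonym ('k, 'l) X3 = "(('k \<times> 'l) \<times> ('k, 'l) X2) \<Rightarrow>\<^sub>0 'k"
type_synonym ('k, 'l) X4 = "(('k, 'l) X2 \<times> ('k, 'l) X2) \<Rightarrow>\<^sub>0 'k"

definition comult ::
  "('k::field \<Rightarrow> 'l::ab_group_add \<Rightarrow> 'l) \<Rightarrow> 'k \<times> 'l \<Rightarrow> ('k, 'l) X2"
  where
  "comult s = (\<lambda>(a, x). pure2 s (a, x) (1, 0) + pure2 s (1, 0) (0, x))"

definition comult3 ::
  "('k::field \<Rightarrow> 'l::ab_group_add \<Rightarrow> 'l) \<Rightarrow> 'k \<times> 'l \<Rightarrow> ('k, 'l) X3"
  where
  "comult3 s x = tensor_map (Xsp s) (Xsp s) (Xsp s) (X2 s) id (comult s) (comult s x)"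

text \<open>
  An expression in Sweedler notation that is trilinear in \<open>x\<^sup>(\<^sup>1\<^sup>), x\<^sup>(\<^sup>2\<^sup>), x\<^sup>(\<^sup>3\<^sup>)\<close> denotes the value at
  \<open>(id \<otimes> \<Delta>) (\<Delta> x)\<close> of the linear map it induces on \<open>X \<otimes> (X \<otimes> X)\<close>.
\<close>

definition sweedler3 ::
  "('k::field \<Rightarrow> 'l::ab_group_add \<Rightarrow> 'l) \<Rightarrow> ('k, 'c::ab_group_add) vspace \<Rightarrow> 'k \<times> 'l
     \<Rightarrow> ('k \<times> 'l \<Rightarrow> 'k \<times> 'l \<Rightarrow> 'k \<times> 'l \<Rightarrow> 'c) \<Rightarrow> 'c"
  where
  "sweedler3 s U x e = lift3 (Xsp s) U e (comult3 s x)"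

definition lie_T ::
  "('k::field \<Rightarrow> 'l::ab_group_add \<Rightarrow> 'l) \<Rightarrow> ('l \<Rightarrow> 'l \<Rightarrow> 'l) \<Rightarrow> ('k, 'l) X3 \<Rightarrow> 'k \<times> 'l"
  where
  "lie_T s br = lift3 (Xsp s) (Xsp s) (\<lambda>(a, x) (b, y) (c, z).
     (a * b * c, s (b * c) x + s c (br x y) + s b (br x z) + br (br x y) z))"

definition three_lie_T ::
  "('k::field \<Rightarrow> 'l::ab_group_add \<Rightarrow> 'l) \<Rightarrow> ('l \<Rightarrow> 'l \<Rightarrow> 'l \<Rightarrow> 'l) \<Rightarrow> ('k, 'l) X3 \<Rightarrow> 'k \<times> 'l"
  where
  "three_lie_T s br = lift3 (Xsp s) (Xsp s) (\<lambda>(a, x) (b, y) (c, z).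
     (a * b * c, s (b * c) x + br x y z))"

definition R_map ::
  "('k::field \<Rightarrow> 'l::ab_group_add \<Rightarrow> 'l) \<Rightarrow> (('k, 'l) X3 \<Rightarrow> 'k \<times> 'l) \<Rightarrow> ('k, 'l) X4 \<Rightarrow> ('k, 'l) X4"
  where
  "R_map s T = lift (X2 s) (X2 s) (X4 s) (\<lambda>u v.
     lift (Xsp s) (Xsp s) (X4 s) (\<lambda>x y.
     lift (Xsp s) (Xsp s) (X4 s) (\<lambda>z w.
       sweedler3 s (X4 s) z (\<lambda>z1 z2 z3. sweedler3 s (X4 s) w (\<lambda>w1 w2 w3.
         pure4 s z1 w1 (T (pure3 s x z2 w2)) (T (pure3 s y z3 w3)))))
     v) u)"

definition theta_map ::
  "('k::field \<Rightarrow> 'l::ab_group_add \<Rightarrow> 'l) \<Rightarrow> (('k, 'l) X3 \<Rightarrow> 'k \<times> 'l) \<Rightarrow> ('k, 'l) X2 \<Rightarrow> ('k, 'l) X2"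
  where
  "theta_map s T = lift (Xsp s) (Xsp s) (X2 s) (\<lambda>x y.
     sweedler3 s (X2 s) x (\<lambda>x1 x2 x3. sweedler3 s (X2 s) y (\<lambda>y1 y2 y3.
       pure2 s (T (pure3 s x1 x2 y2)) (T (pure3 s y1 x3 y3)))))"

end

theory Submission
  imports Defs
begin

text \<open>
  For a 3-Lie algebra every term of \<open>\<theta> (x \<otimes> y)\<close> except \<open>x \<otimes> y\<close> contains a bracket with an
  argument \<open>0\<close>, so \<open>\<theta>\<close> is the identity. For a Lie algebra, writing \<open>1\<close> for \<open>(1, 0)\<close> and \<open>B x y\<close> for
  the bracket of the \<open>L\<close>-components,
  \<open>\<theta> (x \<otimes> y) = x \<otimes> y + B x y \<otimes> 1 + 1 \<otimes> B y x\<close>, while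
  \<open>R (u \<otimes> z \<otimes> w) = z \<otimes> w \<otimes> u + z \<otimes> 1 \<otimes> D w u + 1 \<otimes> w \<otimes> D z u + 1 \<otimes> 1 \<otimes> D w (D z u)\<close>, where \<open>D z\<close>
  is the derivation of \<open>X \<otimes> X\<close> induced by \<open>x \<mapsto> B x z\<close>. The first identity says that \<open>\<theta>\<close> commutes
  with \<open>D z\<close>, which is the Jacobi identity; in the second, the extra terms of \<open>\<theta> (z \<otimes> w)\<close> act by
  \<open>D (B z w) + D (B w z) = 0\<close>.
\<close>

section \<open>Multilinear maps on tensor products\<close>

lemma is_vspace_vector_space: "is_vspace V \<Longrightarrow> vector_space (scl V)"
  by (simp add: is_vspace_def)

lemma
  assumes "is_vspace V"
  shows car_zero: "0 \<in> car V"
    and car_add: "a \<in> car V \<Longrightarrow> b \<in> car V \<Longrightarrow> a + b \<in> car V"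
    and car_scale: "a \<in> car V \<Longrightarrow> scl V c a \<in> car V"
proof -
  interpret vector_space "scl V" using assms by (rule is_vspace_vector_space)
  have S: "subspace (car V)" using assms by (simp add: is_vspace_def)
  show "0 \<in> car V" "a \<in> car V \<Longrightarrow> b \<in> car V \<Longrightarrow> a + b \<in> car V"
    "a \<in> car V \<Longrightarrow> scl V c a \<in> car V"
    using subspace_0[OF S] subspace_add[OF S] subspace_scale[OF S] by blast+
qed

lemma bilinear_onD:
  assumes "bilinear_on V W U f"
  shows "\<And>a a' b. a \<in> car V \<Longrightarrow> a' \<in> car V \<Longrightarrow> b \<in> car W \<Longrightarrow> f (a + a') b = f a b + f a' b"
    and "\<And>a b b'. a \<in> car V \<Longrightarrow> b \<in> car W \<Longrightarrow> b' \<in> car W \<Longrightarrow> f a (b + b') = f a b + f a b'"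
    and "\<And>c a b. a \<in> car V \<Longrightarrow> b \<in> car W \<Longrightarrow> f (scl V c a) b = scl U c (f a b)"
    and "\<And>c a b. a \<in> car V \<Longrightarrow> b \<in> car W \<Longrightarrow> f a (scl W c b) = scl U c (f a b)"
  using assms unfolding bilinear_on_def by auto

lemmas pure_add_left = bilinear_onD(1)[OF bilinear_on_pure]
  and pure_add_right = bilinear_onD(2)[OF bilinear_on_pure]
  and pure_scale_left = bilinear_onD(3)[OF bilinear_on_pure, unfolded scl_tensor]
  and pure_scale_right = bilinear_onD(4)[OF bilinear_on_pure, unfolded scl_tensor]

lemma pure_zero_left: "is_vspace V \<Longrightarrow> b \<in> car W \<Longrightarrow> pure V W 0 b = 0"
  using pure_add_left[of 0 V 0 b W] by (simp add: car_zero)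

lemma pure_zero_right: "is_vspace W \<Longrightarrow> a \<in> car V \<Longrightarrow> pure V W a 0 = 0"
  using pure_add_right[of a V 0 W 0] by (simp add: car_zero)

text \<open>The map \<open>g\<close> itself witnesses the existence claim behind the choice in
  \<open>lift\<close>, so the chosen map agrees with \<open>f\<close> on pure tensors, and these
  determine a linear map on the carrier.\<close>

lemma lift_eqI:
  assumes g: "Vector_Spaces.linear free_scale (scl U) g"
    and eq: "\<And>a b. a \<in> car V \<Longrightarrow> b \<in> car W \<Longrightarrow> g (pure V W a b) = f a b"
    and t: "t \<in> car (tensor V W)"
  shows "lift V W U f t = g t"
proof -
  have "\<exists>h. Vector_Spaces.linear free_scale (scl U) h \<and>
     (\<forall>a\<in>car V. \<forall>b\<in>car W. h (pure V W a b) = f a b)"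
    using g eq by blast
  from someI_ex[OF this] have l: "Vector_Spaces.linear free_scale (scl U) (lift V W U f)"
    "\<And>a b. a \<in> car V \<Longrightarrow> b \<in> car W \<Longrightarrow> lift V W U f (pure V W a b) = f a b"
    unfolding lift_def by blast+
  show ?thesis
    by (rule tensor_linear_ext[OF l(1) g _ t]) (simp add: l(2) eq)
qed

lemma lift_in_car:
  assumes U: "is_vspace U" and f: "bilinear_on V W U f"
    and mem: "\<And>a b. a \<in> car V \<Longrightarrow> b \<in> car W \<Longrightarrow> f a b \<in> car U"
    and t: "t \<in> car (tensor V W)"
  shows "lift V W U f t \<in> car U"
proof -
  note vU = is_vspace_vector_space[OF U]
  interpret l: Vector_Spaces.linear free_scale "scl U" "lift V W U f"
    by (rule linear_lift[OF vU f])
  have "t \<in> free.span {pure V W a b | a b. a \<in> car V \<and> b \<in> car W}"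
    using t by (simp add: tensor_def)
  then show ?thesis
    by (induction rule: free.span_induct_alt)
      (auto simp: l.add l.scale lift_pure[OF vU f] mem U car_zero car_add car_scale)
qed

text \<open>This makes the nested lifts defining \<open>R_map\<close> well behaved. Linearity in
  \<open>u\<close> comes with the outer lift; linearity in \<open>v\<close> follows by comparing
  linear maps on pure tensors.\<close>

lemma bilinear_on_lift:
  fixes F :: "'a::ab_group_add \<Rightarrow> 'b::ab_group_add \<Rightarrow> 'c::ab_group_add \<Rightarrow> 'd::ab_group_add
    \<Rightarrow> 'e::ab_group_add"
  assumes U: "vector_space (scl U)"
    and F1: "\<And>a b. a \<in> car V \<Longrightarrow> b \<in> car W \<Longrightarrow> bilinear_on V' W' U (F a b)"
    and F2: "\<And>c d. c \<in> car V' \<Longrightarrow> d \<in> car W' \<Longrightarrow> bilinear_on V W U (\<lambda>a b. F a b c d)"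
  shows "bilinear_on (tensor V W) (tensor V' W') U
    (\<lambda>u v. lift V W U (\<lambda>a b. lift V' W' U (F a b) v) u)"
proof -
  interpret U: vector_space_pair free_scale "scl U"
    by (simp add: vector_space_pair_def vector_space_free_scale U)
  let ?G = "\<lambda>v a b. lift V' W' U (F a b) v"
  note F_lin = linear_lift[OF U F1]
  note F2D = bilinear_onD[OF F2]
  \<comment> \<open>Each law for fixed \<open>v\<close> equates two maps that are linear in
    \<open>v\<close>, so pure tensors suffice, where it is a law of \<open>F\<close>.\<close>
  have G: "bilinear_on V W U (?G v)" if v: "v \<in> car (tensor V' W')" for v
    unfolding bilinear_on_def
  proof (intro conjI ballI allI)
    fix a a' b assume ab: "a \<in> car V" "a' \<in> car V" "b \<in> car W"
    show "?G v (a + a') b = ?G v a b + ?G v a' b"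
      by (rule lift_eqI[OF U.linear_compose_add[OF F_lin F_lin] _ v])
        (simp_all add: ab lift_pure[OF U F1] F2D)
  next
    fix a b b' assume ab: "a \<in> car V" "b \<in> car W" "b' \<in> car W"
    show "?G v a (b + b') = ?G v a b + ?G v a b'"
      by (rule lift_eqI[OF U.linear_compose_add[OF F_lin F_lin] _ v])
        (simp_all add: ab lift_pure[OF U F1] F2D)
  next
    fix c a b assume ab: "a \<in> car V" "b \<in> car W"
    show "?G v (scl V c a) b = scl U c (?G v a b)"
      by (rule lift_eqI[OF U.linear_compose_scale_right[OF F_lin] _ v])
        (simp_all add: ab lift_pure[OF U F1] F2D)
    show "?G v a (scl W c b) = scl U c (?G v a b)"
      by (rule lift_eqI[OF U.linear_compose_scale_right[OF F_lin] _ v])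
        (simp_all add: ab lift_pure[OF U F1] F2D)
  qed
  note G_lin = linear_lift[OF U G]
  show ?thesis
    unfolding bilinear_on_def scl_tensor
  proof (intro conjI ballI allI)
    fix u u' v assume uv: "u \<in> car (tensor V W)" "u' \<in> car (tensor V W)" "v \<in> car (tensor V' W')"
    interpret l: Vector_Spaces.linear free_scale "scl U" "lift V W U (?G v)" by (rule G_lin[OF uv(3)])
    show "lift V W U (?G v) (u + u') = lift V W U (?G v) u + lift V W U (?G v) u'"
      by (rule l.add)
  next
    fix u v v' assume uv: "u \<in> car (tensor V W)" "v \<in> car (tensor V' W')" "v' \<in> car (tensor V' W')"
    \<comment> \<open>Here \<open>v\<close> is a parameter of the lifted map, so both sides are
      compared as linear maps of \<open>u\<close>.\<close>
    show "lift V W U (?G (v + v')) u = lift V W U (?G v) u + lift V W U (?G v') u"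
    proof (rule lift_eqI[OF U.linear_compose_add[OF G_lin G_lin] _ uv(1)])
      fix a b assume ab: "a \<in> car V" "b \<in> car W"
      interpret l: Vector_Spaces.linear free_scale "scl U" "lift V' W' U (F a b)"
        by (rule F_lin[OF ab])
      show "lift V W U (?G v) (pure V W a b) + lift V W U (?G v') (pure V W a b) = ?G (v + v') a b"
        by (simp add: ab uv lift_pure[OF U G] l.add)
    qed (use uv in auto)
  next
    fix c u v assume uv: "u \<in> car (tensor V W)" "v \<in> car (tensor V' W')"
    interpret l: Vector_Spaces.linear free_scale "scl U" "lift V W U (?G v)" by (rule G_lin[OF uv(2)])
    show "lift V W U (?G v) (free_scale c u) = scl U c (lift V W U (?G v) u)"
      by (rule l.scale)
    show "lift V W U (?G (free_scale c v)) u = scl U c (lift V W U (?G v) u)"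
    proof (rule lift_eqI[OF U.linear_compose_scale_right[OF G_lin] _ uv(1)])
      fix a b assume ab: "a \<in> car V" "b \<in> car W"
      interpret l: Vector_Spaces.linear free_scale "scl U" "lift V' W' U (F a b)"
        by (rule F_lin[OF ab])
      show "scl U c (lift V W U (?G v) (pure V W a b)) = ?G (free_scale c v) a b"
        by (simp add: ab uv lift_pure[OF U G] l.scale)
    qed (use uv in auto)
  qed
qed

text \<open>Two bilinearity conditions cover all three arguments. The first serves the inner lift in
  \<open>lift3\<close>, the second adds linearity in the outermost argument.\<close>

definition trilinear_on where
  "trilinear_on V U f \<longleftrightarrow> (\<forall>a\<in>car V. bilinear_on V V U (f a)) \<and>
     (\<forall>c\<in>car V. bilinear_on V V U (\<lambda>a b. f a b c))"

lemma
  assumes U: "vector_space (scl U)" and f: "trilinear_on V U f"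
  shows linear_lift3: "Vector_Spaces.linear free_scale (scl U) (lift3 V U f)"
    and lift3_pure: "\<And>a b c. a \<in> car V \<Longrightarrow> b \<in> car V \<Longrightarrow> c \<in> car V \<Longrightarrow>
      lift3 V U f (pure V (tensor V V) a (pure V V b c)) = f a b c"
proof -
  interpret U: vector_space_pair free_scale "scl U"
    by (simp add: vector_space_pair_def vector_space_free_scale U)
  have f1: "bilinear_on V V U (f a)" if "a \<in> car V" for a
    using f that by (simp add: trilinear_on_def)
  have f2: "bilinear_on V V U (\<lambda>a b. f a b c)" if "c \<in> car V" for c
    using f that by (simp add: trilinear_on_def)
  note f_lin = linear_lift[OF U f1]
  note f2D = bilinear_onD[OF f2]
  have B: "bilinear_on V (tensor V V) U (\<lambda>a. lift V V U (f a))"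
    unfolding bilinear_on_def scl_tensor
  proof (intro conjI ballI allI)
    fix a a' v assume a: "a \<in> car V" "a' \<in> car V" and v: "v \<in> car (tensor V V)"
    show "lift V V U (f (a + a')) v = lift V V U (f a) v + lift V V U (f a') v"
      by (rule lift_eqI[OF U.linear_compose_add[OF f_lin f_lin] _ v])
        (simp_all add: a lift_pure[OF U f1] f2D)
  next
    fix a v v' assume a: "a \<in> car V"
    interpret l: Vector_Spaces.linear free_scale "scl U" "lift V V U (f a)" by (rule f_lin[OF a])
    show "lift V V U (f a) (v + v') = lift V V U (f a) v + lift V V U (f a) v'"
      by (rule l.add)
  next
    fix c a v assume a: "a \<in> car V" and v: "v \<in> car (tensor V V)"
    interpret l: Vector_Spaces.linear free_scale "scl U" "lift V V U (f a)" by (rule f_lin[OF a])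
    show "lift V V U (f a) (free_scale c v) = scl U c (lift V V U (f a) v)"
      by (rule l.scale)
    show "lift V V U (f (scl V c a)) v = scl U c (lift V V U (f a) v)"
      by (rule lift_eqI[OF U.linear_compose_scale_right[OF f_lin] _ v])
        (simp_all add: a lift_pure[OF U f1] f2D)
  qed
  show "Vector_Spaces.linear free_scale (scl U) (lift3 V U f)"
    unfolding lift3_def by (rule linear_lift[OF U B])
  show "lift3 V U f (pure V (tensor V V) a (pure V V b c)) = f a b c"
    if "a \<in> car V" "b \<in> car V" "c \<in> car V" for a b c
    unfolding lift3_def using that by (simp add: lift_pure[OF U B] lift_pure[OF U f1] pure_in_tensor)
qed

lemma bilinear_on_tensor_map:
  assumes g: "\<And>a a'. a \<in> car V \<Longrightarrow> a' \<in> car V \<Longrightarrow> g (a + a') = g a + g a'"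
      "\<And>c a. a \<in> car V \<Longrightarrow> g (scl V c a) = scl V' c (g a)"
      "\<And>a. a \<in> car V \<Longrightarrow> g a \<in> car V'"
    and h: "\<And>b b'. b \<in> car W \<Longrightarrow> b' \<in> car W \<Longrightarrow> h (b + b') = h b + h b'"
      "\<And>c b. b \<in> car W \<Longrightarrow> h (scl W c b) = scl W' c (h b)"
      "\<And>b. b \<in> car W \<Longrightarrow> h b \<in> car W'"
  shows "bilinear_on V W (tensor V' W') (\<lambda>a b. pure V' W' (g a) (h b))"
  using assms by (simp add: bilinear_on_def pure_add_left pure_add_right pure_scale_left pure_scale_right)

text \<open>The step retains membership of \<open>u\<close> in the carrier, since the bilinear laws
  of \<open>pure\<close> are available only for carrier elements.\<close>

lemma tensor_induct [consumes 1, case_names zero step]: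
  assumes t: "t \<in> car (tensor V W)" and zero: "P 0"
    and step: "\<And>c a b u. a \<in> car V \<Longrightarrow> b \<in> car W \<Longrightarrow> u \<in> car (tensor V W) \<Longrightarrow> P u \<Longrightarrow>
      P (free_scale c (pure V W a b) + u)"
  shows "P t"
proof -
  note V = is_vspace_tensor[of V W]
  have "t \<in> free.span {pure V W a b | a b. a \<in> car V \<and> b \<in> car W}"
    using t by (simp add: tensor_def)
  then have "t \<in> car (tensor V W) \<and> P t"
  proof (induction rule: free.span_induct_alt)
    case base
    show ?case using zero car_zero[OF V] by simp
  next
    case (step c x y)
    then obtain a b where ab: "x = pure V W a b" "a \<in> car V" "b \<in> car W" by blast
    have "free_scale c x \<in> car (tensor V W)"
      using car_scale[OF V pure_in_tensor[OF ab(2,3)], of c] ab(1) by simp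
    then show ?case using step ab assms(3) car_add[OF V] by blast
  qed
  then show ?thesis ..
qed

text \<open>Pure tensors span each of the two factors, so each factor is expanded in turn. This
  reduces identities on \<open>X4\<close> to tensors of four elements of \<open>X\<close>.\<close>

lemma tensor_tensor_linear_ext:
  assumes g: "Vector_Spaces.linear free_scale s g" and h: "Vector_Spaces.linear free_scale s h"
    and eq: "\<And>a b c d. a \<in> car V \<Longrightarrow> b \<in> car W \<Longrightarrow> c \<in> car V' \<Longrightarrow> d \<in> car W' \<Longrightarrow>
      g (pure (tensor V W) (tensor V' W') (pure V W a b) (pure V' W' c d)) =
      h (pure (tensor V W) (tensor V' W') (pure V W a b) (pure V' W' c d))"
    and t: "t \<in> car (tensor (tensor V W) (tensor V' W'))"
  shows "g t = h t"
proof (rule tensor_linear_ext[OF g h _ t])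
  let ?p = "pure (tensor V W) (tensor V' W')"
  interpret g: Vector_Spaces.linear free_scale s g by (rule g)
  interpret h: Vector_Spaces.linear free_scale s h by (rule h)
  note VW = is_vspace_tensor[of V W] and VW' = is_vspace_tensor[of V' W']
  note scale = car_scale[OF VW, unfolded scl_tensor] car_scale[OF VW', unfolded scl_tensor]
    pure_scale_left[where V = "tensor V W", unfolded scl_tensor]
    pure_scale_right[where W = "tensor V' W'", unfolded scl_tensor]
  note simps = scale pure_zero_left[OF VW] pure_zero_right[OF VW'] pure_add_left pure_add_right
    pure_in_tensor g.add g.scale h.add h.scale
  fix u v assume u: "u \<in> car (tensor V W)" and v: "v \<in> car (tensor V' W')"
  \<comment> \<open>The first factor is expanded while the second stays pure; the second is expanded
    afterwards.\<close>
  have 1: "g (?p u (pure V' W' c d)) = h (?p u (pure V' W' c d))"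
    if "c \<in> car V'" "d \<in> car W'" for c d
    using u by (induction rule: tensor_induct) (simp_all add: that simps eq)
  show "g (?p u v) = h (?p u v)"
    using v by (induction rule: tensor_induct) (simp_all add: u simps 1)
qed

lemma linear_tensor_map:
  assumes "bilinear_on V W (tensor V' W') (\<lambda>a b. pure V' W' (g a) (h b))"
  shows "Vector_Spaces.linear free_scale free_scale (tensor_map V W V' W' g h)"
    and "\<And>a b. a \<in> car V \<Longrightarrow> b \<in> car W \<Longrightarrow>
      tensor_map V W V' W' g h (pure V W a b) = pure V' W' (g a) (h b)"
  using linear_lift[OF _ assms] lift_pure[OF _ assms]
  by (simp_all add: tensor_map_def vector_space_free_scale)

lemma tensor_map_id:
  assumes "\<forall>a\<in>car V. g a = a" "\<forall>b\<in>car W. h b = b" "t \<in> car (tensor V W)"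
  shows "tensor_map V W V W g h t = t"
  unfolding tensor_map_def
  by (rule lift_eqI[where g = "\<lambda>x. x"])
    (use assms in \<open>auto simp: vector_space_free_scale free.linear_ident\<close>)

section \<open>Coproducts on \<open>k \<oplus> L\<close>\<close>

definition unitX :: "'k::field \<times> 'l::ab_group_add" where "unitX = (1, 0)"

text \<open>The projection of \<open>X\<close> onto its summand \<open>L\<close>. With it the
  coproduct reads \<open>x \<otimes> unitX + unitX \<otimes> projL x\<close>, with no splitting of
  pairs.\<close>

definition projL :: "'k::field \<times> 'l::ab_group_add \<Rightarrow> 'k \<times> 'l" where "projL x = (0, snd x)"

lemma projL_simps [simp]:
  "projL unitX = 0" "projL (projL x) = projL x" "projL 0 = 0"
  "projL (x + y) = projL x + projL y"
  by (simp_all add: projL_def unitX_def zero_prod_def)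

locale ground_space =
  fixes s :: "'k::field \<Rightarrow> 'l::ab_group_add \<Rightarrow> 'l"
  assumes vector_space_s: "vector_space s"
begin

lemma scl_Xsp: "scl (Xsp s) r x = (r * fst x, s r (snd x))"
proof -
  interpret s: vector_space s by (rule vector_space_s)
  interpret vector_space_prod "(*) :: 'k \<Rightarrow> 'k \<Rightarrow> 'k" s
    by unfold_locales (simp_all add: algebra_simps)
  show ?thesis by (simp add: Xsp_def scale_def)
qed

lemma car_Xsp [simp]: "car (Xsp s) = UNIV"
  by (simp add: Xsp_def)

lemma vector_space_Xsp: "vector_space (scl (Xsp s))"
proof -
  interpret s: vector_space s by (rule vector_space_s)
  interpret vector_space_prod "(*) :: 'k \<Rightarrow> 'k \<Rightarrow> 'k" s
    by unfold_locales (simp_all add: algebra_simps)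
  show ?thesis by (simp add: Xsp_def p.vector_space_axioms)
qed

lemma is_vspace_Xsp: "is_vspace (Xsp s)"
proof -
  interpret vector_space "scl (Xsp s)" by (rule vector_space_Xsp)
  show ?thesis by (simp add: is_vspace_def vector_space_Xsp subspace_UNIV)
qed

lemma projL_scale: "projL (scl (Xsp s) c x) = scl (Xsp s) c (projL x)"
  by (simp add: projL_def scl_Xsp)

lemma pure2_mem [simp]: "pure2 s x y \<in> car (X2 s)"
  by (simp add: pure_in_tensor)

lemma pure2_simps:
  "pure2 s (x + x') y = pure2 s x y + pure2 s x' y"
  "pure2 s x (y + y') = pure2 s x y + pure2 s x y'"
  "pure2 s (scl (Xsp s) c x) y = free_scale c (pure2 s x y)"
  "pure2 s x (scl (Xsp s) c y) = free_scale c (pure2 s x y)"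
  "pure2 s 0 y = 0" "pure2 s x 0 = 0"
  by (simp_all add: pure_add_left pure_add_right pure_scale_left pure_scale_right
      pure_zero_left pure_zero_right is_vspace_Xsp)

lemma X2_mem:
  "0 \<in> car (X2 s)"
  "u \<in> car (X2 s) \<Longrightarrow> v \<in> car (X2 s) \<Longrightarrow> u + v \<in> car (X2 s)"
  "u \<in> car (X2 s) \<Longrightarrow> free_scale c u \<in> car (X2 s)"
  by (rule car_zero[OF is_vspace_tensor] car_add[OF is_vspace_tensor]
      car_scale[OF is_vspace_tensor, unfolded scl_tensor]; assumption)+

lemma pure_X2_simps:
  assumes "u \<in> car (X2 s)" "v \<in> car W"
  shows "u' \<in> car (X2 s) \<Longrightarrow> pure (X2 s) W (u + u') v = pure (X2 s) W u v + pure (X2 s) W u' v"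
    and "v' \<in> car W \<Longrightarrow> pure (X2 s) W u (v + v') = pure (X2 s) W u v + pure (X2 s) W u v'"
    and "pure (X2 s) W (free_scale c u) v = free_scale c (pure (X2 s) W u v)"
    and "pure (X2 s) W u (scl W c v) = free_scale c (pure (X2 s) W u v)"
    and "pure (X2 s) W 0 v = 0"
  using assms pure_scale_left[where V = "X2 s", unfolded scl_tensor]
  by (simp_all add: pure_add_left pure_add_right pure_scale_right pure_zero_left is_vspace_tensor)

text \<open>Scalars of \<open>X2 s\<close> appear as \<open>free_scale\<close>, a form that the law
  stated with \<open>scl W\<close> does not match.\<close>

lemma pure_into_X2_simps:
  assumes "u \<in> car V"
  shows "v \<in> car (X2 s) \<Longrightarrow> pure V (X2 s) u (free_scale c v) = free_scale c (pure V (X2 s) u v)"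
    and "pure V (X2 s) u 0 = 0"
  using assms pure_scale_right[where W = "X2 s", unfolded scl_tensor]
  by (simp_all add: pure_zero_right is_vspace_tensor)

lemmas pure4_simps = pure2_simps X2_mem pure_X2_simps pure_into_X2_simps

lemma trilinear_on_XspI:
  assumes "\<And>x x' y z. e (x + x') y z = e x y z + e x' y z"
    and "\<And>x y y' z. e x (y + y') z = e x y z + e x y' z"
    and "\<And>x y z z'. e x y (z + z') = e x y z + e x y z'"
    and "\<And>c x y z. e (scl (Xsp s) c x) y z = scl U c (e x y z)"
    and "\<And>c x y z. e x (scl (Xsp s) c y) z = scl U c (e x y z)"
    and "\<And>c x y z. e x y (scl (Xsp s) c z) = scl U c (e x y z)"
  shows "trilinear_on (Xsp s) U e"
  using assms by (simp add: trilinear_on_def bilinear_on_def)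

section \<open>The iterated coproduct and Sweedler sums\<close>

lemma comult_eq: "comult s x = pure2 s x unitX + pure2 s unitX (projL x)"
  by (cases x) (simp add: comult_def unitX_def projL_def)

text \<open>As \<open>projL\<close> kills \<open>unitX\<close> and is idempotent, the coproduct
  sends \<open>unitX\<close> to \<open>unitX \<otimes> unitX\<close> and \<open>projL x\<close> to
  \<open>projL x \<otimes> unitX + unitX \<otimes> projL x\<close>.\<close>

lemma comult3_eq:
  "comult3 s x = pure3 s x unitX unitX + pure3 s unitX (projL x) unitX + pure3 s unitX unitX (projL x)"
proof -
  have B: "bilinear_on (Xsp s) (Xsp s) (X3 s) (\<lambda>a b. pure (Xsp s) (X2 s) (id a) (comult s b))"
    by (rule bilinear_on_tensor_map)
      (simp_all add: comult_eq X2_mem pure2_simps projL_scale free.scale_right_distrib)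
  interpret l: Vector_Spaces.linear free_scale free_scale
      "tensor_map (Xsp s) (Xsp s) (Xsp s) (X2 s) id (comult s)"
    by (rule linear_tensor_map(1)[OF B])
  show ?thesis
    by (simp add: comult3_def comult_eq[of x] l.add linear_tensor_map(2)[OF B])
      (simp add: comult_eq pure_add_right pure2_simps)
qed

definition sweedler_sum :: "('k \<times> 'l \<Rightarrow> 'k \<times> 'l \<Rightarrow> 'k \<times> 'l \<Rightarrow> 'c::ab_group_add) \<Rightarrow> 'k \<times> 'l \<Rightarrow> 'c"
  where "sweedler_sum e x = e x unitX unitX + e unitX (projL x) unitX + e unitX unitX (projL x)"

lemma sweedler3_eq:
  assumes U: "vector_space (scl U)" and e: "trilinear_on (Xsp s) U e"
  shows "sweedler3 s U x e = sweedler_sum e x"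
proof -
  interpret l: Vector_Spaces.linear free_scale "scl U" "lift3 (Xsp s) U e"
    by (rule linear_lift3[OF U e])
  show ?thesis
    by (simp add: sweedler3_def comult3_eq l.add lift3_pure[OF U e] sweedler_sum_def)
qed

end

section \<open>The maps \<open>R\<close> and \<open>\<theta>\<close> of a trilinear operation\<close>

text \<open>Both versions of \<open>T\<close> are induced by a trilinear operation \<open>t\<close>,
  so linearity of \<open>R\<close> and \<theta> and the reduction to pure tensors are treated once
  for both.\<close>

locale ternary_operation = ground_space s
  for s :: "'k::field \<Rightarrow> 'l::ab_group_add \<Rightarrow> 'l" +
  fixes t :: "'k \<times> 'l \<Rightarrow> 'k \<times> 'l \<Rightarrow> 'k \<times> 'l \<Rightarrow> 'k \<times> 'l"
    and T :: "('k, 'l) X3 \<Rightarrow> 'k \<times> 'l"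
  assumes trilinear_t: "trilinear_on (Xsp s) (Xsp s) t"
    and T_def: "T = lift3 (Xsp s) (Xsp s) t"
begin

lemma T_pure3 [simp]: "T (pure3 s x y z) = t x y z"
  unfolding T_def by (simp add: lift3_pure[OF vector_space_Xsp trilinear_t])

lemma t_linear:
  "t (x + x') y z = t x y z + t x' y z"
  "t x (y + y') z = t x y z + t x y' z"
  "t x y (z + z') = t x y z + t x y z'"
  "t (scl (Xsp s) c x) y z = scl (Xsp s) c (t x y z)"
  "t x (scl (Xsp s) c y) z = scl (Xsp s) c (t x y z)"
  "t x y (scl (Xsp s) c z) = scl (Xsp s) c (t x y z)"
  using trilinear_t
  by (simp_all add: trilinear_on_def bilinear_on_def del: split_paired_All)

lemma t_zero: "t 0 y z = 0" "t x 0 z = 0" "t x y 0 = 0"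
  using t_linear(1)[of 0 0 y z] t_linear(2)[of x 0 0 z] t_linear(3)[of x y 0 0] by simp_all

definition R4 :: "'k \<times> 'l \<Rightarrow> 'k \<times> 'l \<Rightarrow> 'k \<times> 'l \<Rightarrow> 'k \<times> 'l \<Rightarrow> ('k, 'l) X4" where
  "R4 x y z w = sweedler_sum (\<lambda>z1 z2 z3. sweedler_sum (\<lambda>w1 w2 w3.
     pure4 s z1 w1 (t x z2 w2) (t y z3 w3)) w) z"

lemmas multilinear_simps = pure4_simps t_linear t_zero projL_scale free.scale_right_distrib

lemma R_map_eq_lift:
  "R_map s T = lift (X2 s) (X2 s) (X4 s) (\<lambda>u v.
     lift (Xsp s) (Xsp s) (X4 s) (\<lambda>x y. lift (Xsp s) (Xsp s) (X4 s) (R4 x y) v) u)"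
proof -
  have vs: "vector_space (scl (X4 s))" by (simp add: vector_space_free_scale)
  \<comment> \<open>The inner Sweedler expression becomes a sum for all fixed \<open>z1\<close>,
    \<open>z2\<close>, \<open>z3\<close>; only then is the outer one seen to be trilinear.\<close>
  have w: "trilinear_on (Xsp s) (X4 s) (\<lambda>w1 w2 w3. pure4 s z1 w1 (t x z2 w2) (t y z3 w3))"
    for x y z1 z2 z3
    by (rule trilinear_on_XspI) (simp_all add: multilinear_simps)
  have z: "trilinear_on (Xsp s) (X4 s)
      (\<lambda>z1 z2 z3. sweedler_sum (\<lambda>w1 w2 w3. pure4 s z1 w1 (t x z2 w2) (t y z3 w3)) w)" for x y w
    by (rule trilinear_on_XspI) (simp_all add: multilinear_simps sweedler_sum_def)
  show ?thesis
    unfolding R_map_def R4_def T_pure3 sweedler3_eq[OF vs w] sweedler3_eq[OF vs z] ..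
qed

lemma bilinear_on_R4:
  "bilinear_on (Xsp s) (Xsp s) (X4 s) (R4 x y)"
  "bilinear_on (Xsp s) (Xsp s) (X4 s) (\<lambda>x y. R4 x y z w)"
  by (simp_all add: bilinear_on_def R4_def sweedler_sum_def multilinear_simps ac_simps)

lemma bilinear_on_lift_R4:
  "bilinear_on (X2 s) (X2 s) (X4 s) (\<lambda>u v.
     lift (Xsp s) (Xsp s) (X4 s) (\<lambda>x y. lift (Xsp s) (Xsp s) (X4 s) (R4 x y) v) u)"
  by (rule bilinear_on_lift) (simp_all add: vector_space_free_scale bilinear_on_R4)

lemma linear_R_map: "Vector_Spaces.linear free_scale free_scale (R_map s T)"
  using linear_lift[OF _ bilinear_on_lift_R4]
  by (simp add: R_map_eq_lift vector_space_free_scale)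

lemma R_map_pure4: "R_map s T (pure4 s x y z w) = R4 x y z w"
proof -
  have vs: "vector_space (scl (X4 s))" by (simp add: vector_space_free_scale)
  \<comment> \<open>The inner lift at \<open>pure2 s z w\<close> is \<open>R4 x y z w\<close>, so
    the outer lift can be evaluated as well.\<close>
  have "bilinear_on (Xsp s) (Xsp s) (X4 s)
     (\<lambda>x y. lift (Xsp s) (Xsp s) (X4 s) (R4 x y) (pure2 s z w))"
    by (simp add: lift_pure[OF vs bilinear_on_R4(1)] bilinear_on_R4)
  then show ?thesis
    by (simp add: R_map_eq_lift lift_pure[OF vs bilinear_on_lift_R4] lift_pure[OF vs]
        bilinear_on_R4)
qed

section \<open>The map \<theta> on pure tensors\<close>

definition theta2 :: "'k \<times> 'l \<Rightarrow> 'k \<times> 'l \<Rightarrow> ('k, 'l) X2" where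
  "theta2 x y = sweedler_sum (\<lambda>x1 x2 x3. sweedler_sum (\<lambda>y1 y2 y3.
     pure2 s (t x1 x2 y2) (t y1 x3 y3)) y) x"

lemma theta_map_eq_lift: "theta_map s T = lift (Xsp s) (Xsp s) (X2 s) theta2"
proof -
  have vs: "vector_space (scl (X2 s))" by (simp add: vector_space_free_scale)
  have y: "trilinear_on (Xsp s) (X2 s) (\<lambda>y1 y2 y3. pure2 s (t x1 x2 y2) (t y1 x3 y3))"
    for x1 x2 x3
    by (rule trilinear_on_XspI) (simp_all add: multilinear_simps)
  have x: "trilinear_on (Xsp s) (X2 s)
      (\<lambda>x1 x2 x3. sweedler_sum (\<lambda>y1 y2 y3. pure2 s (t x1 x2 y2) (t y1 x3 y3)) y)" for y
    by (rule trilinear_on_XspI) (simp_all add: multilinear_simps sweedler_sum_def)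
  have "theta2 = (\<lambda>x y. sweedler_sum (\<lambda>x1 x2 x3. sweedler_sum (\<lambda>y1 y2 y3.
     pure2 s (t x1 x2 y2) (t y1 x3 y3)) y) x)"
    by (intro ext) (rule theta2_def)
  then show ?thesis
    unfolding theta_map_def T_pure3 sweedler3_eq[OF vs y] sweedler3_eq[OF vs x] by simp
qed

lemma bilinear_on_theta2: "bilinear_on (Xsp s) (Xsp s) (X2 s) theta2"
  by (simp add: bilinear_on_def theta2_def sweedler_sum_def multilinear_simps ac_simps)

lemma linear_theta_map: "Vector_Spaces.linear free_scale free_scale (theta_map s T)"
  and theta_map_pure2: "theta_map s T (pure2 s x y) = theta2 x y"
  using linear_lift[OF _ bilinear_on_theta2] lift_pure[OF _ bilinear_on_theta2]
  by (simp_all add: theta_map_eq_lift vector_space_free_scale)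

text \<open>This lets \<theta> act on one factor of \<open>X4\<close>: \<open>pure\<close> is
  bilinear only on carriers.\<close>

lemma theta_map_in_X2: "u \<in> car (X2 s) \<Longrightarrow> theta_map s T u \<in> car (X2 s)"
  unfolding theta_map_eq_lift
  by (rule lift_in_car[OF is_vspace_tensor bilinear_on_theta2])
    (simp_all add: theta2_def sweedler_sum_def X2_mem)

section \<open>Reduction of the commutation identities to pure tensors\<close>

abbreviation "theta_left \<equiv> tensor_map (X2 s) (X2 s) (X2 s) (X2 s) (theta_map s T) id"
abbreviation "theta_right \<equiv> tensor_map (X2 s) (X2 s) (X2 s) (X2 s) id (theta_map s T)"

lemma bilinear_on_theta:
  "bilinear_on (X2 s) (X2 s) (X4 s) (\<lambda>u v. pure (X2 s) (X2 s) (theta_map s T u) (id v))"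
  "bilinear_on (X2 s) (X2 s) (X4 s) (\<lambda>u v. pure (X2 s) (X2 s) (id u) (theta_map s T v))"
proof -
  interpret \<theta>: Vector_Spaces.linear free_scale free_scale "theta_map s T"
    by (rule linear_theta_map)
  show "bilinear_on (X2 s) (X2 s) (X4 s) (\<lambda>u v. pure (X2 s) (X2 s) (theta_map s T u) (id v))"
    "bilinear_on (X2 s) (X2 s) (X4 s) (\<lambda>u v. pure (X2 s) (X2 s) (id u) (theta_map s T v))"
    by (rule bilinear_on_tensor_map; simp add: \<theta>.add \<theta>.scale theta_map_in_X2)+
qed

lemma linear_theta_left: "Vector_Spaces.linear free_scale free_scale theta_left"
  and theta_left_pure: "u \<in> car (X2 s) \<Longrightarrow> v \<in> car (X2 s) \<Longrightarrow>
    theta_left (pure (X2 s) (X2 s) u v) = pure (X2 s) (X2 s) (theta_map s T u) v"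
  and linear_theta_right: "Vector_Spaces.linear free_scale free_scale theta_right"
  and theta_right_pure: "u \<in> car (X2 s) \<Longrightarrow> v \<in> car (X2 s) \<Longrightarrow>
    theta_right (pure (X2 s) (X2 s) u v) = pure (X2 s) (X2 s) u (theta_map s T v)"
  using linear_tensor_map[where h = id, OF bilinear_on_theta(1)]
    linear_tensor_map[where g = id, OF bilinear_on_theta(2)]
  by simp_all

text \<open>Both sides are composites of linear maps, hence determined by their values on
  \<open>pure4 s x y z w\<close>, where the inner maps are already evaluated in the
  premises.\<close>

lemma R_map_theta_commuteI:
  assumes "\<And>x y z w. R_map s T (pure (X2 s) (X2 s) (theta2 x y) (pure2 s z w)) =
      theta_right (R4 x y z w)"
    and "\<And>x y z w. R_map s T (pure (X2 s) (X2 s) (pure2 s x y) (theta2 z w)) =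
      theta_left (R4 x y z w)"
  shows "(\<forall>u \<in> car (X4 s). R_map s T (theta_left u) = theta_right (R_map s T u)) \<and>
    (\<forall>u \<in> car (X4 s). R_map s T (theta_right u) = theta_left (R_map s T u))"
proof (intro conjI ballI)
  note comp = Vector_Spaces.linear_compose[unfolded comp_def]
  fix u assume u: "u \<in> car (X4 s)"
  show "R_map s T (theta_left u) = theta_right (R_map s T u)"
    by (rule tensor_tensor_linear_ext[OF comp[OF linear_theta_left linear_R_map]
          comp[OF linear_R_map linear_theta_right] _ u])
      (simp add: theta_left_pure theta_map_pure2 R_map_pure4 assms(1))
  show "R_map s T (theta_right u) = theta_left (R_map s T u)"
    by (rule tensor_tensor_linear_ext[OF comp[OF linear_theta_right linear_R_map]
          comp[OF linear_R_map linear_theta_left] _ u])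
      (simp add: theta_right_pure theta_map_pure2 R_map_pure4 assms(2))
qed

lemma R4_in_X4: "R4 x y z w \<in> car (X4 s)"
  by (simp add: R4_def sweedler_sum_def pure_in_tensor car_add[OF is_vspace_tensor])

text \<open>Then \<theta> acts as the identity on either factor of \<open>X4\<close>, and
  \<open>R4\<close> takes its values there, so both identities compare \<open>R\<close> with
  itself.\<close>

lemma R_map_theta_commute_of_theta_trivial:
  assumes "\<And>x y. theta2 x y = pure2 s x y"
  shows "(\<forall>u \<in> car (X4 s). R_map s T (theta_left u) = theta_right (R_map s T u)) \<and>
    (\<forall>u \<in> car (X4 s). R_map s T (theta_right u) = theta_left (R_map s T u))"
proof -
  have "theta_map s T v = v" if "v \<in> car (X2 s)" for v
    unfolding theta_map_eq_lift
    by (rule lift_eqI[where g = "\<lambda>x. x", OF _ _ that])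
      (simp_all add: assms vector_space_free_scale free.linear_ident)
  then have "theta_left u = u" "theta_right u = u" if "u \<in> car (X4 s)" for u
    using that by (simp_all add: tensor_map_id)
  then show ?thesis
    by (intro R_map_theta_commuteI) (simp_all add: assms R_map_pure4 R4_in_X4)
qed

end

text \<open>
  With \<open>B x y\<close> the bracket of the \<open>L\<close>-components, \<open>t\<close> is the iteration of the binary operation
  \<open>(x, y) \<mapsto> b x + B x y\<close>, where \<open>b\<close> is the \<open>k\<close>-component of \<open>y\<close>.
\<close>

locale lie_ternary_operation = ternary_operation s t T
  for s :: "'k::field \<Rightarrow> 'l::ab_group_add \<Rightarrow> 'l" and t T +
  fixes B :: "'k \<times> 'l \<Rightarrow> 'k \<times> 'l \<Rightarrow> 'k \<times> 'l"
  assumes t_unit: "t x unitX unitX = x"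
    and t_B: "t x (projL y) unitX = B x y" "t x unitX (projL y) = B x y"
    and t_BB: "t x (projL y) (projL z) = B (B x y) z"
    and B_unit: "B unitX y = 0" "B y unitX = 0"
    and jacobi: "B (B x y) z = B (B x z) y + B x (B y z)"
    and B_skew: "B x (B y z) + B x (B z y) = 0"
begin

lemma B_add: "B (x + x') y = B x y + B x' y"
  by (simp add: t_linear flip: t_B(2))

lemma B_zero: "B 0 y = 0" "B x 0 = 0"
  using t_B[of 0 y] t_B[of x 0] by (simp_all add: t_zero)

text \<open>Of the nine terms only three survive: whenever \<open>t\<close> has \<open>unitX\<close>
  in its first slot and an element of \<open>L\<close> in a later one, a bracket with
  \<open>unitX\<close> makes it vanish.\<close>

lemma theta2_eq: "theta2 x y = pure2 s x y + pure2 s (B x y) unitX + pure2 s unitX (B y x)"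
  by (simp add: theta2_def sweedler_sum_def t_unit t_B t_BB B_unit B_zero pure2_simps t_zero)

text \<open>Each of \<open>z\<close> and \<open>w\<close> either moves to the front or leaves
  \<open>unitX\<close> there and acts on \<open>x\<close> or on \<open>y\<close>, which gives nine
  terms. When both act on the same element, \<open>z\<close> acts first.\<close>

lemma R4_eq: "R4 x y z w =
  pure4 s z w x y + pure4 s z unitX (B x w) y + pure4 s z unitX x (B y w) +
  pure4 s unitX w (B x z) y + pure4 s unitX w x (B y z) +
  pure4 s unitX unitX (B (B x z) w) y + pure4 s unitX unitX (B x z) (B y w) +
  pure4 s unitX unitX (B x w) (B y z) + pure4 s unitX unitX x (B (B y z) w)"
  by (simp add: R4_def sweedler_sum_def t_unit t_B t_BB B_unit B_zero ac_simps)

lemma R_map_theta_commute: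
  "(\<forall>u \<in> car (X4 s). R_map s T (theta_left u) = theta_right (R_map s T u)) \<and>
   (\<forall>u \<in> car (X4 s). R_map s T (theta_right u) = theta_left (R_map s T u))"
proof (rule R_map_theta_commuteI)
  interpret R: Vector_Spaces.linear free_scale free_scale "R_map s T" by (rule linear_R_map)
  interpret l: Vector_Spaces.linear free_scale free_scale theta_left by (rule linear_theta_left)
  interpret r: Vector_Spaces.linear free_scale free_scale theta_right by (rule linear_theta_right)
  fix x y z w
  \<comment> \<open>As a rewrite rule \<open>jacobi\<close> would swap \<open>y\<close> and
    \<open>z\<close> forever. These instances only move \<open>z\<close> and \<open>w\<close>
    inwards, for the brackets \<open>B x y\<close> and \<open>B y x\<close> occurring in
    \<open>theta2 x y\<close>.\<close>
  have J: "B (B a b) z = B (B a z) b + B a (B b z)" "B (B a b) w = B (B a w) b + B a (B b w)"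
    "B (B (B a z) b) w = B (B (B a z) w) b + B (B a z) (B b w)"
    "B (B a (B b z)) w = B (B a w) (B b z) + B a (B (B b z) w)" 
    if "(a, b) = (x, y) \<or> (a, b) = (y, x)" for a b
    using jacobi by blast+
  note J' = J[of x y, simplified] J[of y x, simplified]
  show "R_map s T (pure (X2 s) (X2 s) (theta2 x y) (pure2 s z w)) = theta_right (R4 x y z w)"
    by (simp add: theta2_eq R4_eq r.add theta_right_pure theta_map_pure2 pure4_simps
        R.add R_map_pure4 B_unit B_zero) (simp add: J' B_add pure4_simps ac_simps)
  \<comment> \<open>These are the surplus terms that \<open>R\<close> produces when
    \<open>B z w\<close> and \<open>B w z\<close> act on \<open>x\<close> and \<open>y\<close>; they
    cancel in pairs by \<open>B_skew\<close>.\<close>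
  have "pure4 s unitX unitX (B x (B z w)) y + pure4 s unitX unitX (B x (B w z)) y = 0"
    "pure4 s unitX unitX x (B y (B z w)) + pure4 s unitX unitX x (B y (B w z)) = 0"
    by (simp_all add: B_skew pure2_simps X2_mem pure_into_X2_simps
        flip: pure_X2_simps(2) pure2_simps(1,2))
  then show "R_map s T (pure (X2 s) (X2 s) (pure2 s x y) (theta2 z w)) = theta_left (R4 x y z w)"
    by (simp add: theta2_eq R4_eq l.add theta_left_pure theta_map_pure2 pure4_simps
        R.add R_map_pure4 B_unit B_zero) (simp add: algebra_simps)
qed

end

section \<open>Lie algebras and 3-Lie algebras\<close>

lemma linearD:
  assumes "Vector_Spaces.linear p q g"
  shows "g (x + y) = g x + g y" and "g (p c x) = q c (g x)" and "g 0 = 0"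
  using Vector_Spaces.linear.axioms(3)[OF assms] module_hom.zero module_hom.add
    module_hom.scale by blast+

text \<open>Besides linearity, this turns the cyclic Jacobi identity into the statement that
  bracketing with \<open>z\<close> on the right is a derivation.\<close>

lemma lie_algebraD:
  assumes "lie_algebra s br"
  shows "vector_space s"
    and "br (x + x') y = br x y + br x' y" "br x (y + y') = br x y + br x y'"
    and "br (s c x) y = s c (br x y)" "br x (s c y) = s c (br x y)"
    and "br 0 y = 0" "br x 0 = 0"
    and "br y x = - br x y"
    and "br (br x y) z = br (br x z) y + br x (br y z)"
proof -
  have l: "Vector_Spaces.linear s s (\<lambda>y. br x y)" "Vector_Spaces.linear s s (\<lambda>x. br x y)"
    and alt: "br x x = 0"
    and jac: "br x (br y z) + br y (br z x) + br z (br x y) = 0" for x y z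
    using assms by (auto simp: lie_algebra_def)
  show "vector_space s" using assms by (simp add: lie_algebra_def)
  show add: "br (x + x') y = br x y + br x' y" "br x (y + y') = br x y + br x y'" for x x' y y'
    using linearD(1)[OF l(1)] linearD(1)[OF l(2)] by blast+
  show "br (s c x) y = s c (br x y)" "br x (s c y) = s c (br x y)"
    using linearD(2)[OF l(1)] linearD(2)[OF l(2)] by blast+
  show zero: "br 0 y = 0" "br x 0 = 0" for x y
    using linearD(3)[OF l(1)] linearD(3)[OF l(2)] by blast+
  \<comment> \<open>Expanding the vanishing bracket of \<open>x + y\<close> with itself leaves
    \<open>br x y + br y x = 0\<close>, in every characteristic.\<close>
  show skew: "br y x = - br x y" for x y
    using alt[of "x + y"] unfolding add by (simp add: alt eq_neg_iff_add_eq_0 add.commute)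
  have minus: "br x (- y) = - br x y" for x y
    using add(2)[of x y "- y"] by (simp add: zero eq_neg_iff_add_eq_0 add.commute)
  \<comment> \<open>Skew-symmetry is used for the outer and the inner bracket, and the two signs
    cancel.\<close>
  have "br (br x z) y = br y (br z x)"
    by (subst skew, subst skew) (simp add: minus)
  moreover have "br (br x y) z = - br z (br x y)"
    by (rule skew)
  moreover have "- br z (br x y) = br y (br z x) + br x (br y z)"
    unfolding neg_eq_iff_add_eq_0 using jac[of x y z] by (simp only: ac_simps)
  ultimately show "br (br x y) z = br (br x z) y + br x (br y z)"
    by simp
qed

lemma three_lie_algebraD:
  assumes "three_lie_algebra s br"
  shows "vector_space s"
    and "br (x + x') y z = br x y z + br x' y z" "br x (y + y') z = br x y z + br x y' z"
      "br x y (z + z') = br x y z + br x y z'"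
    and "br (s c x) y z = s c (br x y z)" "br x (s c y) z = s c (br x y z)"
      "br x y (s c z) = s c (br x y z)"
    and "br 0 y z = 0" "br x 0 z = 0" "br x y 0 = 0"
proof -
  have l: "Vector_Spaces.linear s s (\<lambda>x. br x y z)" "Vector_Spaces.linear s s (\<lambda>y. br x y z)"
    "Vector_Spaces.linear s s (\<lambda>z. br x y z)" for x y z
    using assms by (auto simp: three_lie_algebra_def)
  show "vector_space s" using assms by (simp add: three_lie_algebra_def)
  show "br (x + x') y z = br x y z + br x' y z" "br x (y + y') z = br x y z + br x y' z"
    "br x y (z + z') = br x y z + br x y z'"
    using linearD(1)[OF l(1)] linearD(1)[OF l(2)] linearD(1)[OF l(3)] by blast+
  show "br (s c x) y z = s c (br x y z)" "br x (s c y) z = s c (br x y z)"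
    "br x y (s c z) = s c (br x y z)"
    using linearD(2)[OF l(1)] linearD(2)[OF l(2)] linearD(2)[OF l(3)] by blast+
  show "br 0 y z = 0" "br x 0 z = 0" "br x y 0 = 0"
    using linearD(3)[OF l(1)] linearD(3)[OF l(2)] linearD(3)[OF l(3)] by blast+
qed

lemma lie_ternary_operation_lie_T:
  fixes s :: "'k::field \<Rightarrow> 'l::ab_group_add \<Rightarrow> 'l"
  assumes "lie_algebra s br"
  shows "lie_ternary_operation s (\<lambda>(a, x) (b, y) (c, z).
      (a * b * c, s (b * c) x + s c (br x y) + s b (br x z) + br (br x y) z))
    (lie_T s br) (\<lambda>x y. (0, br (snd x) (snd y)))"
proof -
  note br = lie_algebraD[OF assms]
  interpret s: vector_space s by (rule br(1))
  interpret ground_space s by unfold_locales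
  show ?thesis
  proof (unfold_locales, rule trilinear_on_XspI, goal_cases)
    \<comment> \<open>Goals 1 to 6 are trilinearity, 7 is \<open>T_def\<close>, 14 is
      \<open>jacobi\<close> and 15 is \<open>B_skew\<close>.\<close>
    case 7
    show ?case by (simp add: lie_T_def)
  next
    case (14 x y z)
    show ?case using br(9)[of "snd x" "snd y" "snd z"] by simp
  next
    case (15 x y z)
    show ?case
      using br(3)[of "snd x" "br (snd y) (snd z)" "br (snd z) (snd y)"] br(8)[of "snd y" "snd z"]
      by (simp add: br(7) zero_prod_def)
  qed (auto simp: scl_Xsp br(2-7) unitX_def projL_def zero_prod_def algebra_simps
      s.scale_right_distrib s.scale_left_distrib split: prod.splits)
qed

lemma ternary_operation_three_lie_T:
  fixes s :: "'k::field \<Rightarrow> 'l::ab_group_add \<Rightarrow> 'l"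
  assumes "three_lie_algebra s br"
  shows "ternary_operation s (\<lambda>(a, x) (b, y) (c, z). (a * b * c, s (b * c) x + br x y z))
    (three_lie_T s br)"
proof -
  note br = three_lie_algebraD[OF assms]
  interpret s: vector_space s by (rule br(1))
  interpret ground_space s by unfold_locales
  show ?thesis
  proof (unfold_locales, rule trilinear_on_XspI)
    show "three_lie_T s br =
      lift3 (Xsp s) (Xsp s) (\<lambda>(a, x) (b, y) (c, z). (a * b * c, s (b * c) x + br x y z))"
      by (simp add: three_lie_T_def)
  qed (auto simp: scl_Xsp br algebra_simps s.scale_right_distrib s.scale_left_distrib
      split: prod.splits)
qed

theorem lemma5p1:
  fixes s :: "'k::field \<Rightarrow> 'l::ab_group_add \<Rightarrow> 'l"
    and T :: "('k, 'l) X3 \<Rightarrow> 'k \<times> 'l"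
  assumes "(\<exists>br. lie_algebra s br \<and> T = lie_T s br) \<or>
           (\<exists>br. three_lie_algebra s br \<and> T = three_lie_T s br)"
  shows "(\<forall>t \<in> car (X4 s).
            R_map s T (tensor_map (X2 s) (X2 s) (X2 s) (X2 s) (theta_map s T) id t) =
            tensor_map (X2 s) (X2 s) (X2 s) (X2 s) id (theta_map s T) (R_map s T t)) \<and>
         (\<forall>t \<in> car (X4 s).
            R_map s T (tensor_map (X2 s) (X2 s) (X2 s) (X2 s) id (theta_map s T) t) =
            tensor_map (X2 s) (X2 s) (X2 s) (X2 s) (theta_map s T) id (R_map s T t))"
  using assms
proof (elim disjE exE conjE)
  fix br assume "lie_algebra s br" "T = lie_T s br"
  then show ?thesis
    using lie_ternary_operation.R_map_theta_commute[OF lie_ternary_operation_lie_T] by simp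
next
  fix br assume br: "three_lie_algebra s br" and T: "T = three_lie_T s br"
  interpret ternary_operation s "\<lambda>(a, x) (b, y) (c, z). (a * b * c, s (b * c) x + br x y z)" T
    unfolding T using br by (rule ternary_operation_three_lie_T)
  interpret s: vector_space s by (rule vector_space_s)
  \<comment> \<open>Evaluating \<open>t\<close> on explicit pairs yields zero as
    \<open>(0, 0)\<close>.\<close>
  have [simp]: "pure2 s (0, 0) y = 0" "pure2 s x (0, 0) = 0" for x y
    using pure2_simps(5,6) by (simp_all add: zero_prod_def)
  have "theta2 x y = pure2 s x y" for x y
    \<comment> \<open>In every term but \<open>x \<otimes> y\<close>, one value of \<open>t\<close>
      has an element of \<open>L\<close> in its second or third slot. Its scalar part and the
      multiple of its first argument then vanish, and its bracket has an argument
      \<open>0\<close>.\<close>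
    by (cases x; cases y)
      (simp add: theta2_def sweedler_sum_def unitX_def projL_def three_lie_algebraD[OF br])
  then show ?thesis by (rule R_map_theta_commute_of_theta_trivial)
qed

end
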